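(* Let $p$ be a prime and $d$ an integer with $d\mid p-1$, $1<d<p-1$ and $d\notin\{2,6\}$. Then there is no set $A\subseteq\mathbb F_p$ such that the pair $(A,-A)$ is $d$-critical, except possibly when $p=41$ and $d=20$.
   Context: $\mu_d$ denotes the set of $d$-th roots of unity in $\mathbb F_p$. A pair $(A,B)$ of subsets of $\mathbb F_p$ with $|A|,|B|>1$ is called $d$-critical if $A+B=\{a+b:a\in A,b\in B\}\subseteq\mu_d\cup\{0\}$ and $|A||B|=d+|(-A)\cap B|$, where $-A=\{-a:a\in A\}$. *)

theory Defs
  imports "Berlekamp_Zassenhaus.Finite_Field"
begin

text \<open>
  The prime field with \<open>p\<close> elements is the type \<open>'p mod_ring\<close> with \<open>'p :: prime_card\<close>,
  where \<open>p = CARD('p)\<close>; the class \<open>prime_card\<close> says exactly that this number is prime.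
\<close>

definition roots_unity :: "nat \<Rightarrow> 'p::prime_card mod_ring set" where
  "roots_unity d = {x. x ^ d = 1}"

definition d_critical ::
    "nat \<Rightarrow> 'p::prime_card mod_ring set \<Rightarrow> 'p mod_ring set \<Rightarrow> bool" where
  "d_critical d A B \<longleftrightarrow>
     card A > 1 \<and> card B > 1 \<and>
     {a + b | a b. a \<in> A \<and> b \<in> B} \<subseteq> roots_unity d \<union> {0} \<and>
     card A * card B = d + card (uminus ` A \<inter> B)"

end

theory Submission imports Defs begin

text \<open>
  Let \<open>n = |A|\<close>, so that \<open>d = n (n - 1)\<close>, and let \<open>P\<close> be the monic polynomial with root set \<open>A\<close>.
  The equality case of the Hanson--Petridis (Stepanov) argument is the identity
  \<open>\<Sum>\<^sub>a (x - a)^(n\<^sup>2 - 1) / P'(a) = (-1)^(n - 1) (1 + binom(n\<^sup>2 - 1, n - 1) P^(n - 1))\<close>.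
  Expanding it at a root \<open>a\<close> of \<open>P\<close> shows that \<open>P\<close> agrees with \<open>P'(a) t (1 - s t)^n\<close> modulo \<open>t\<^sup>5\<close>,
  where \<open>t = x - a\<close> and \<open>s\<close> depends on \<open>a\<close>. Hence the fourth transvectant with itself of \<open>P\<close>, viewed
  as a binary form of degree \<open>n + 1\<close> with an additional root at infinity, is divisible by \<open>P\<^sup>2\<close>, so it
  vanishes for degree reasons. As in the classification of the forms with this property (the vertices of
  the tetrahedron, octahedron and icosahedron), comparing the two highest terms
  \<open>x^n + c x^(n - j)\<close> of a centred \<open>P\<close> leaves only \<open>(n, j) = (5, 4)\<close> and \<open>(11, 5)\<close>.
  In these two cases the coefficient of \<open>x^(d - j)\<close> in the identity restricts \<open>p\<close> to the prime
  divisors of an explicit integer.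
\<close>

lemma binomial_absorption_step: "Suc k * (n choose Suc k) = (n - k) * (n choose k)"
  using binomial_absorb_comp[of n k] binomial_absorption[of k n] by simp

section \<open>Polynomials with prescribed roots and Lagrange interpolation\<close>

definition root_poly :: "'a::field set \<Rightarrow> 'a poly" where
  "root_poly A = (\<Prod>a\<in>A. [:-a, 1:])"

text \<open>For finite \<open>A\<close> and \<open>a\<close> in \<open>A\<close> this is 1/P'(a),
  where P is \<open>root_poly A\<close>.\<close>

definition lagrange_weight :: "'a::field set \<Rightarrow> 'a \<Rightarrow> 'a" where
  "lagrange_weight A a = inverse (\<Prod>b\<in>A - {a}. a - b)"

lemma degree_root_poly: "finite A \<Longrightarrow> degree (root_poly A) = card A"
  unfolding root_poly_def by (subst degree_prod_eq_sum_degree) auto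

lemma coeff_root_poly_card: "finite A \<Longrightarrow> coeff (root_poly A) (card A) = 1"
  using lead_coeff_prod[of "\<lambda>a. [:-a, 1:]" A] degree_root_poly[of A]
  by (simp add: root_poly_def)

lemma root_poly_nonzero: "finite A \<Longrightarrow> root_poly A \<noteq> 0"
  using coeff_root_poly_card[of A] by auto

lemma poly_root_poly_eq_0_iff: "finite A \<Longrightarrow> poly (root_poly A) x = 0 \<longleftrightarrow> x \<in> A"
  by (auto simp: root_poly_def poly_prod)

lemma root_poly_remove:
  "finite A \<Longrightarrow> a \<in> A \<Longrightarrow> root_poly A = [:-a, 1:] * root_poly (A - {a})"
  unfolding root_poly_def by (rule prod.remove)

lemma root_poly_translate: "root_poly ((\<lambda>x. x - c) ` A) = pcompose (root_poly A) [:c, 1:]"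
proof -
  have "root_poly ((\<lambda>x. x - c) ` A) = (\<Prod>a\<in>A. [:-(a - c), 1:])"
    unfolding root_poly_def by (subst prod.reindex) (auto simp: inj_on_def)
  then show ?thesis
    by (simp add: root_poly_def pcompose_prod pcompose_pCons)
qed

lemma lagrange_weight_translate:
  "lagrange_weight ((\<lambda>x. x - c) ` A) (a - c) = lagrange_weight A a"
proof -
  have "(\<lambda>x. x - c) ` A - {a - c} = (\<lambda>x. x - c) ` (A - {a})" by auto
  then show ?thesis
    unfolding lagrange_weight_def
    by (simp, subst prod.reindex) (auto simp: inj_on_def)
qed

lemma coeff_root_poly_pred:
  "finite A \<Longrightarrow> A \<noteq> {} \<Longrightarrow> coeff (root_poly A) (card A - 1) = - \<Sum>A"
proof (induction A rule: finite_ne_induct)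
  case (singleton x)
  then show ?case by (simp add: root_poly_def)
next
  case (insert x F)
  obtain k where k: "card F = Suc k" using insert by (cases "card F") auto
  have "root_poly (insert x F) = [:-x, 1:] * root_poly F"
    using insert by (simp add: root_poly_def)
  then show ?case
    using insert k coeff_root_poly_card[of F] by (simp add: coeff_pCons split: nat.split)
qed

lemma lagrange_interpolation:
  assumes "finite A" "degree q < card A"
  shows "q = (\<Sum>a\<in>A. smult (poly q a * lagrange_weight A a) (root_poly (A - {a})))"
proof (rule poly_eqI_degree[of A])
  fix x assume x: "x \<in> A"
  have "poly (\<Sum>a\<in>A. smult (poly q a * lagrange_weight A a) (root_poly (A - {a}))) x
      = (\<Sum>a\<in>A. if a = x then poly q x else 0)"
    unfolding poly_sum
  proof (rule sum.cong[OF refl])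
    fix a assume "a \<in> A"
    show "poly (smult (poly q a * lagrange_weight A a) (root_poly (A - {a}))) x
        = (if a = x then poly q x else 0)"
    proof (cases "a = x")
      case True
      have "(\<Prod>b\<in>A - {x}. x - b) \<noteq> 0" using assms(1) by simp
      then show ?thesis using True
        by (simp add: lagrange_weight_def root_poly_def poly_prod)
    next
      case False
      then show ?thesis using x assms(1) by (simp add: poly_root_poly_eq_0_iff)
    qed
  qed
  then show "poly q x = poly (\<Sum>a\<in>A. smult (poly q a * lagrange_weight A a) (root_poly (A - {a}))) x"
    using x assms(1) by simp
next
  show "degree (\<Sum>a\<in>A. smult (poly q a * lagrange_weight A a) (root_poly (A - {a}))) < card A"
  proof -
    have "degree (\<Sum>a\<in>A. smult (poly q a * lagrange_weight A a) (root_poly (A - {a}))) \<le> card A - 1"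
      using assms(1)
      by (intro degree_sum_le order.trans[OF degree_smult_le]) (auto simp: degree_root_poly)
    then show ?thesis using assms(2) by linarith
  qed
qed (use assms in auto)

text \<open>Compare the coefficients of x^(n-1), n = \<open>card A\<close>, in the interpolation
  formula: each basis polynomial is monic of degree n - 1.\<close>

lemma sum_lagrange_weight_poly:
  assumes "finite A" "degree q < card A"
  shows "(\<Sum>a\<in>A. lagrange_weight A a * poly q a) = coeff q (card A - 1)"
proof -
  have "coeff q (card A - 1)
      = (\<Sum>a\<in>A. poly q a * lagrange_weight A a * coeff (root_poly (A - {a})) (card A - 1))"
    by (subst lagrange_interpolation[OF assms]) (simp add: coeff_sum)
  also have "\<dots> = (\<Sum>a\<in>A. lagrange_weight A a * poly q a)"
  proof (rule sum.cong[OF refl])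
    fix a assume "a \<in> A"
    then have "coeff (root_poly (A - {a})) (card A - 1) = 1"
      using assms(1) coeff_root_poly_card[of "A - {a}"] by simp
    then show "poly q a * lagrange_weight A a * coeff (root_poly (A - {a})) (card A - 1)
      = lagrange_weight A a * poly q a" by simp
  qed
  finally show ?thesis by simp
qed

lemma sum_lagrange_weight_power:
  assumes "finite A" "k < card A"
  shows "(\<Sum>a\<in>A. lagrange_weight A a * (c * a) ^ k) = (if k = card A - 1 then c ^ k else 0)"
  using sum_lagrange_weight_poly[of A "monom (c ^ k) k"] assms degree_monom_le[of "c ^ k" k]
  by (auto simp: poly_monom power_mult_distrib le_less_trans)

text \<open>Multiply a^(j-1) P(a) = 0 by the weight of a and sum over \<open>A\<close>. Weighted
  power sums of exponent below n - 1 vanish, and the gap removes the indices strictly between n - j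
  and n, so only these two indices survive.\<close>

lemma sum_lagrange_weight_power_beyond:
  assumes "finite A" "1 \<le> j" "j \<le> card A"
    and gap: "\<And>i. card A - j < i \<Longrightarrow> i < card A \<Longrightarrow> coeff (root_poly A) i = 0"
  shows "(\<Sum>a\<in>A. lagrange_weight A a * a ^ (card A - 1 + j)) = - coeff (root_poly A) (card A - j)"
proof -
  let ?L = "\<lambda>k. \<Sum>a\<in>A. lagrange_weight A a * a ^ k"
  let ?n = "card A"
  have L: "?L k = (if k = ?n - 1 then 1 else 0)" if "k < ?n" for k
    using sum_lagrange_weight_power[OF assms(1) that, of 1] by simp
  have "0 = (\<Sum>a\<in>A. lagrange_weight A a * (a ^ (j - 1) * poly (root_poly A) a))"
    using assms(1) poly_root_poly_eq_0_iff[of A] by (intro sum.neutral[symmetric]) auto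
  also have "\<dots> = (\<Sum>a\<in>A. \<Sum>i\<le>?n. coeff (root_poly A) i * (lagrange_weight A a * a ^ (j - 1 + i)))"
    by (simp add: poly_altdef degree_root_poly assms(1) sum_distrib_left power_add mult_ac)
  also have "\<dots> = (\<Sum>i\<le>?n. coeff (root_poly A) i * ?L (j - 1 + i))"
    by (subst sum.swap) (simp add: sum_distrib_left)
  also have "\<dots> = (\<Sum>i\<in>{?n - j, ?n}. coeff (root_poly A) i * ?L (j - 1 + i))"
  proof (rule sum.mono_neutral_right)
    show "\<forall>i\<in>{..?n} - {?n - j, ?n}. coeff (root_poly A) i * ?L (j - 1 + i) = 0"
    proof
      fix i assume i: "i \<in> {..?n} - {?n - j, ?n}"
      show "coeff (root_poly A) i * ?L (j - 1 + i) = 0"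
      proof (cases "i < ?n - j")
        case True
        then show ?thesis using L[of "j - 1 + i"] assms by simp
      next
        case False
        then show ?thesis using gap[of i] i by simp
      qed
    qed
  qed auto
  also have "\<dots> = coeff (root_poly A) (?n - j) + ?L (?n - 1 + j)"
  proof -
    have "j - 1 + (?n - j) = ?n - 1" "j - 1 + ?n = ?n - 1 + j" using assms by auto
    moreover have "?n - j \<noteq> ?n" using assms by auto
    ultimately show ?thesis
      using L[of "?n - 1"] assms coeff_root_poly_card[of A] by simp
  qed
  finally show ?thesis by (simp add: eq_neg_iff_add_eq_0 add.commute)
qed

section \<open>Divisibility by powers of linear factors\<close>

lemma root_poly_power_dvd:
  assumes "finite A" "\<And>a. a \<in> A \<Longrightarrow> [:-a, 1:] ^ k dvd f"
  shows "root_poly A ^ k dvd f"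
  using assms
proof (induction A arbitrary: f rule: finite_induct)
  case empty
  then show ?case by (simp add: root_poly_def)
next
  case (insert x F)
  then have "[:-x, 1:] ^ k dvd f" by simp
  then obtain g where g: "f = [:-x, 1:] ^ k * g" by (elim dvdE)
  have "[:-a, 1:] ^ k dvd g" if a: "a \<in> F" for a
  proof (cases "g = 0")
    case False
    have "a \<noteq> x" using a insert by auto
    then have "order a ([:-x, 1:] ^ k) = 0" by (intro order_0I) simp
    moreover have "f \<noteq> 0" using False g by simp
    ultimately have "order a f = order a g" using g by (simp add: order_mult)
    then show ?thesis using insert.prems[of a] a \<open>f \<noteq> 0\<close> by (simp add: order_divides)
  qed simp
  then have "root_poly F ^ k dvd g" by (rule insert.IH)
  then show ?case using insert.hyps g
    by (simp add: root_poly_def power_mult_distrib mult_dvd_mono del: mult_pCons_left)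
qed

text \<open>Translation by a turns \<open>[:-a, 1:]\<close> into x. This allows every local
  computation to be made at the root 0.\<close>

lemma linear_power_dvd_iff:
  fixes f :: "'a::field poly"
  shows "[:-a, 1:] ^ k dvd f \<longleftrightarrow> (\<forall>i<k. coeff (pcompose f [:a, 1:]) i = 0)"
proof -
  have shift: "pcompose (pcompose f [:a, 1:]) [:-a, 1:] = f"
    by (simp add: pcompose_assoc[symmetric] pcompose_pCons)
  have "[:-a, 1:] ^ k dvd f \<longleftrightarrow> monom 1 k dvd pcompose f [:a, 1:]"
  proof
    assume "[:-a, 1:] ^ k dvd f"
    then obtain g where "f = [:-a, 1:] ^ k * g" by (elim dvdE)
    then have "pcompose f [:a, 1:] = monom 1 k * pcompose g [:a, 1:]"
      by (simp add: pcompose_mult pcompose_hom.hom_power pcompose_pCons monom_altdef)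
    then show "monom 1 k dvd pcompose f [:a, 1:]" by simp
  next
    assume "monom 1 k dvd pcompose f [:a, 1:]"
    then obtain g where "pcompose f [:a, 1:] = monom 1 k * g" by (elim dvdE)
    then have "f = [:-a, 1:] ^ k * pcompose g [:-a, 1:]"
      using shift by (simp add: pcompose_mult pcompose_hom.hom_power pcompose_pCons monom_altdef)
    then show "[:-a, 1:] ^ k dvd f" by simp
  qed
  then show ?thesis by (simp add: monom_1_dvd_iff')
qed

text \<open>
  Here \<open>1 + \<alpha> t + \<beta> t\<^sup>2 + \<gamma> t\<^sup>3\<close> is the start of \<open>P / (P'(a) t)\<close>, \<open>y\<^sub>i\<close> are the coefficients of its
  \<open>(n - 1)\<close>-st power, \<open>s\<^sub>i\<close> up to sign those of its inverse, and \<open>C\<^sub>i\<close> is the binomial coefficient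
  \<open>binom(n\<^sup>2 - 1, n - 1 + i)\<close>.
\<close>

lemma local_coefficient_relations:
  fixes n \<alpha> \<beta> \<gamma> :: "'a::field"
  assumes y: "y1 = (n - 1) * \<alpha>" "2 * y2 + \<alpha> * y1 = (n - 1) * (2 * \<beta> + \<alpha> * y1)"
      "3 * y3 + 2 * \<alpha> * y2 + \<beta> * y1 = (n - 1) * (3 * \<gamma> + 2 * \<beta> * y1 + \<alpha> * y2)"
    and s: "s2 = \<beta> - \<alpha>^2" "s3 = - \<gamma> + 2 * \<alpha> * \<beta> - \<alpha>^3"
    and C: "C1 * n = n * (n - 1) * C0" "C2 * (n + 1) = (n * (n - 1) - 1) * C1"
      "C3 * (n + 2) = (n * (n - 1) - 2) * C2"
    and Cs: "C2 * s2 = - C0 * y2" "C3 * s3 = - C0 * y3"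
    and nz: "C0 \<noteq> 0" "n \<noteq> 0" "n - 1 \<noteq> 0" "n - 3 \<noteq> 0" "n + 1 \<noteq> 0" "(2::'a) \<noteq> 0"
  shows "2 * n * \<beta> = (n - 1) * \<alpha>^2" "3 * n * \<gamma> = (n - 2) * \<alpha> * \<beta>"
proof -
  have C1: "C1 = (n - 1) * C0" using C(1) nz by (simp add: mult_ac)
  note C2 = C(2)[unfolded C1]
  have "2 * y2 = (2 * y2 + \<alpha> * y1) - \<alpha> * y1" by simp
  also have "\<dots> = (n - 1) * (2 * \<beta> + (n - 2) * \<alpha>^2)" unfolding y(2) unfolding y(1) by (simp add: algebra_simps power2_eq_square power3_eq_cube)
  finally have y2: "2 * y2 = (n - 1) * (2 * \<beta> + (n - 2) * \<alpha>^2)" .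
  \<comment> \<open>The factor 2 (n + 1) makes the known expressions for \<open>C2 * (n + 1)\<close>
    and \<open>2 * y2\<close> applicable; the result is a nonzero multiple of the first
    relation.\<close>
  have "0 = 2 * (n + 1) * (C2 * s2 + C0 * y2)" by (simp add: Cs)
  also have "\<dots> = 2 * s2 * (C2 * (n + 1)) + (n + 1) * C0 * (2 * y2)" by (simp add: algebra_simps power2_eq_square power3_eq_cube)
  also have "\<dots> = C0 * (n - 1) * n * (2 * n * \<beta> - (n - 1) * \<alpha>^2)" unfolding C2 y2 s by (simp add: algebra_simps power2_eq_square power3_eq_cube)
  finally show r: "2 * n * \<beta> = (n - 1) * \<alpha>^2" using nz by simp
  have "(n + 1) * (C3 * (n + 2)) = (n * (n - 1) - 2) * (C2 * (n + 1))" unfolding C(3) by (simp add: algebra_simps power2_eq_square power3_eq_cube)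
  also have "\<dots> = (n + 1) * ((n - 2) * (n * (n - 1) - 1) * (n - 1) * C0)" unfolding C2 by (simp add: algebra_simps power2_eq_square power3_eq_cube)
  finally have C3: "C3 * (n + 2) = (n - 2) * (n * (n - 1) - 1) * (n - 1) * C0" using nz by simp
  have "6 * y3 = 2 * (3 * y3 + 2 * \<alpha> * y2 + \<beta> * y1) - 2 * \<alpha> * (2 * y2) - 2 * \<beta> * y1" by (simp add: algebra_simps power2_eq_square power3_eq_cube)
  also have "\<dots> = (n - 1) * (6 * \<gamma> + 4 * \<beta> * y1 + \<alpha> * (2 * y2)) - 2 * \<alpha> * (2 * y2) - 2 * \<beta> * y1"
    unfolding y(3) by (simp add: algebra_simps power2_eq_square power3_eq_cube)
  also have "\<dots> = (n - 1) * (6 * \<gamma> + 6 * (n - 2) * \<alpha> * \<beta> + (n - 2) * (n - 3) * \<alpha>^3)"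
    unfolding y2 y(1) by (simp add: algebra_simps power2_eq_square power3_eq_cube)
  finally have y3: "6 * y3 = (n - 1) * (6 * \<gamma> + 6 * (n - 2) * \<alpha> * \<beta> + (n - 2) * (n - 3) * \<alpha>^3)" .
  \<comment> \<open>After the analogous substitution the third-order relation is a combination of
    both claims. The second enters with a factor n - 3, which must not vanish.\<close>
  have "0 = 6 * (n + 2) * (C3 * s3 + C0 * y3)" by (simp add: Cs)
  also have "\<dots> = 6 * s3 * (C3 * (n + 2)) + (n + 2) * C0 * (6 * y3)" by (simp add: algebra_simps power2_eq_square power3_eq_cube)
  also have "\<dots> = C0 * (n - 1) * (5 * n * (n - 2) * \<alpha> * (2 * n * \<beta> - (n - 1) * \<alpha>^2)
      - 2 * n * (n - 3) * (3 * n * \<gamma> - (n - 2) * \<alpha> * \<beta>))"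
    unfolding C3 y3 s by (simp add: algebra_simps power2_eq_square power3_eq_cube)
  finally show "3 * n * \<gamma> = (n - 2) * \<alpha> * \<beta>" using nz r by simp
qed

section \<open>The left-hand side of the equality-case identity\<close>

definition weighted_power_sum :: "'a::field set \<Rightarrow> nat \<Rightarrow> 'a poly" where
  "weighted_power_sum A N = (\<Sum>a\<in>A. smult (lagrange_weight A a) ([:-a, 1:] ^ N))"

lemma coeff_weighted_power_sum:
  "i \<le> N \<Longrightarrow> coeff (weighted_power_sum A N) i
    = of_nat (N choose i) * (\<Sum>a\<in>A. lagrange_weight A a * (-a) ^ (N - i))"
  by (simp add: weighted_power_sum_def coeff_sum coeff_linear_poly_power sum_distrib_left mult_ac)

lemma degree_weighted_power_sum: "degree (weighted_power_sum A N) \<le> N"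
  unfolding weighted_power_sum_def
  by (cases "finite A") (auto intro!: degree_sum_le order.trans[OF degree_smult_le]
      simp: degree_linear_power)

lemma weighted_power_sum_translate:
  "weighted_power_sum ((\<lambda>x. x - c) ` A) N = pcompose (weighted_power_sum A N) [:c, 1:]"
proof -
  have "weighted_power_sum ((\<lambda>x. x - c) ` A) N
      = (\<Sum>a\<in>A. smult (lagrange_weight A a) ([:-(a - c), 1:] ^ N))"
    unfolding weighted_power_sum_def
    by (subst sum.reindex) (auto simp: inj_on_def lagrange_weight_translate)
  then show ?thesis
    by (simp add: weighted_power_sum_def pcompose_sum pcompose_smult pcompose_hom.hom_power
        pcompose_pCons)
qed

section \<open>Coefficients of powers and products of polynomials with gaps\<close>

lemma coeff_power_gap:
  fixes p :: "'a::comm_ring_1 poly"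
  assumes "coeff p 0 = 1" "\<And>i. 0 < i \<Longrightarrow> i < j \<Longrightarrow> coeff p i = 0" "i \<le> j"
  shows "coeff (p ^ k) i = (if i = 0 then 1 else of_nat k * coeff p i)"
  using assms(3)
proof (induction k arbitrary: i)
  case 0
  then show ?case by auto
next
  case (Suc k)
  show ?case
  proof (cases "i = 0")
    case True
    then show ?thesis using Suc.IH[of 0] assms(1) by (simp add: coeff_mult)
  next
    case False
    \<comment> \<open>An index strictly between 0 and i lies in the gap, so there are no cross
      terms.\<close>
    have "coeff (p ^ Suc k) i = (\<Sum>l\<in>{0, i}. coeff p l * coeff (p ^ k) (i - l))"
      unfolding power_Suc coeff_mult
      by (rule sum.mono_neutral_right) (use assms(2) Suc.prems in auto)
    then show ?thesis
      using False Suc.IH[of 0] Suc.IH[of i] Suc.prems assms(1) by (simp add: algebra_simps)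
  qed
qed

text \<open>\<open>reflect_poly\<close> turns the gap below the leading term into a gap above the
  constant term, where \<open>coeff_power_gap\<close> applies.\<close>

lemma coeff_power_below_top:
  fixes p :: "'a::field poly"
  assumes "coeff p (degree p) = 1" "1 \<le> j" "j \<le> degree p" "1 \<le> k"
    and gap: "\<And>i. degree p - j < i \<Longrightarrow> i < degree p \<Longrightarrow> coeff p i = 0"
  shows "coeff (p ^ k) (degree p * k - j) = of_nat k * coeff p (degree p - j)"
proof -
  have "p \<noteq> 0" using assms(1) by auto
  then have deg: "degree (p ^ k) = degree p * k" by (simp add: degree_power_eq)
  have le: "j \<le> degree p * k" using assms by (metis mult.right_neutral mult_le_mono)
  have "coeff (reflect_poly p ^ k) j = of_nat k * coeff (reflect_poly p) j"
  proof (subst coeff_power_gap[where j = j])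
    show "coeff (reflect_poly p) i = 0" if "0 < i" "i < j" for i
      using that gap[of "degree p - i"] assms by (auto simp: coeff_reflect_poly)
  qed (use assms in auto)
  then show ?thesis
    using le assms deg by (simp add: reflect_poly_power[symmetric] coeff_reflect_poly)
qed

text \<open>An index i > m other than n falls into the gap of \<open>p\<close>; for i < m the
  complementary index exceeds n and the coefficient of \<open>q\<close> vanishes.\<close>

lemma coeff_mult_two_top_terms:
  fixes p q :: "'a::comm_ring_1 poly"
  assumes "m < n" "\<And>i. m < i \<Longrightarrow> i \<noteq> n \<Longrightarrow> coeff p i = 0" "\<And>i. m < i \<Longrightarrow> i \<noteq> n \<Longrightarrow> coeff q i = 0"
  shows "coeff (p * q) (n + m) = coeff p n * coeff q m + coeff p m * coeff q n"
proof -
  have "coeff (p * q) (n + m) = (\<Sum>i\<in>{m, n}. coeff p i * coeff q (n + m - i))"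
    unfolding coeff_mult
  proof (rule sum.mono_neutral_right)
    show "\<forall>i\<in>{..n + m} - {m, n}. coeff p i * coeff q (n + m - i) = 0"
    proof
      fix i assume i: "i \<in> {..n + m} - {m, n}"
      show "coeff p i * coeff q (n + m - i) = 0"
        using i assms(1) assms(2)[of i] assms(3)[of "n + m - i"] by (cases "m < i") auto
    qed
  qed auto
  then show ?thesis using assms(1) by simp
qed

text \<open>Multiplication by x^k undoes the degree shift of the derivatives, so the operator is
  diagonal on monomials. For i < k the product contains the zero factor l = i.\<close>

lemma coeff_monom_mult_pderiv_funpow:
  fixes p :: "'a::field poly"
  shows "coeff (monom 1 k * (pderiv ^^ k) p) i = (\<Prod>l<k. of_nat i - of_nat l) * coeff p i"
proof (induction k arbitrary: i p)
  case 0
  then show ?case by (simp add: monom_0)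
next
  case (Suc k)
  show ?case
  proof (cases i)
    case 0
    then show ?thesis by (simp add: coeff_monom_mult prod.lessThan_Suc_shift del: prod.lessThan_Suc)
  next
    case (Suc i')
    have "coeff (monom 1 (Suc k) * (pderiv ^^ Suc k) p) i
        = coeff (monom 1 k * (pderiv ^^ k) (pderiv p)) i'"
      by (simp add: Suc coeff_monom_mult funpow_Suc_right del: funpow.simps)
    also have "\<dots> = (\<Prod>l<Suc k. of_nat i - of_nat l) * coeff p i"
      by (simp only: Suc.IH) (simp add: Suc coeff_pderiv prod.lessThan_Suc_shift algebra_simps
          del: prod.lessThan_Suc)
    finally show ?thesis .
  qed
qed

section \<open>The fourth transvectant\<close>

text \<open>
  Up to a constant and modulo dehomogenization, the fourth transvectant with itself of the binary form
  of degree \<open>n + 1\<close> given by a polynomial \<open>p\<close> of degree \<open>n\<close>.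
\<close>

definition transvectant4 :: "'a::field \<Rightarrow> 'a poly \<Rightarrow> 'a poly" where
  "transvectant4 n p = smult (n * (n + 1)) (p * (pderiv ^^ 4) p)
     - smult (4 * n * (n - 2)) (pderiv p * (pderiv ^^ 3) p)
     + smult (3 * (n - 1) * (n - 2)) ((pderiv ^^ 2) p * (pderiv ^^ 2) p)"

lemma pderiv_funpow_pcompose_shift:
  "(pderiv ^^ k) (pcompose p [:c, 1:]) = pcompose ((pderiv ^^ k) p) [:c, 1:]" for p :: "'a::field poly"
  by (induction k) (simp_all add: pderiv_pcompose pderiv_pCons)

text \<open>Lets the order of vanishing at a root be checked after moving that root to 0.\<close>

lemma transvectant4_pcompose_shift:
  "transvectant4 n (pcompose p [:c, 1:]) = pcompose (transvectant4 n p) [:c, 1:]"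
  by (simp add: transvectant4_def pderiv_funpow_pcompose_shift pderiv_pcompose pderiv_pCons pcompose_add pcompose_diff
      pcompose_smult pcompose_mult del: funpow.simps)

lemma degree_pderiv_funpow: "degree ((pderiv ^^ k) p) \<le> degree p - k" for p :: "'a::field poly"
proof (induction k)
  case (Suc k)
  then show ?case using degree_pderiv_le[of "(pderiv ^^ k) p"] by simp
qed simp

text \<open>The bound is strict so that divisibility by the square of \<open>p\<close> forces the
  transvectant to be zero.\<close>

lemma degree_transvectant4:
  assumes "2 \<le> degree p"
  shows "degree (transvectant4 n p) < 2 * degree p"
proof -
  have "degree (p * (pderiv ^^ 4) p) \<le> 2 * degree p - 1"
    using degree_mult_le[of p "(pderiv ^^ 4) p"] degree_pderiv_funpow[of 4 p] assms by linarith
  moreover have "degree (pderiv p * (pderiv ^^ 3) p) \<le> 2 * degree p - 1"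
    using degree_mult_le[of "pderiv p" "(pderiv ^^ 3) p"] degree_pderiv_funpow[of 3 p]
      degree_pderiv_le[of p] assms by linarith
  moreover have "degree ((pderiv ^^ 2) p * (pderiv ^^ 2) p) \<le> 2 * degree p - 1"
    using degree_mult_le[of "(pderiv ^^ 2) p" "(pderiv ^^ 2) p"] degree_pderiv_funpow[of 2 p]
      assms by linarith
  ultimately have "degree (transvectant4 n p) \<le> 2 * degree p - 1"
    unfolding transvectant4_def
    by (intro degree_add_le degree_diff_le order.trans[OF degree_smult_le])
  then show ?thesis using assms by linarith
qed

text \<open>When the constant term of \<open>p\<close> is 0, the two lowest coefficients are the two
  differences in \<open>r\<close> multiplied by -12 (n - 2) and -24 (n - 3).\<close>

lemma coeff_transvectant4_low:
  fixes p :: "'a::field poly"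
  assumes "coeff p 0 = 0"
    and r: "2 * n * coeff p 1 * coeff p 3 = (n - 1) * coeff p 2 * coeff p 2"
      "3 * n * coeff p 1 * coeff p 4 = (n - 2) * coeff p 2 * coeff p 3"
    and "i < 2"
  shows "coeff (transvectant4 n p) i = 0"
proof -
  have c: "coeff (p * q) 0 = coeff p 0 * coeff q 0"
    "coeff (p * q) (Suc 0) = coeff p 0 * coeff q (Suc 0) + coeff p (Suc 0) * coeff q 0"
    for p q :: "'a poly"
    by (simp_all add: coeff_mult)
  define a b e f where "a = coeff p 1" "b = coeff p 2" "e = coeff p 3" "f = coeff p 4"
  note abef = this
  have r': "2 * n * a * e = (n - 1) * b * b" "3 * n * a * f = (n - 2) * b * e"
    using r by (simp_all add: abef mult_ac)
  have s: "coeff p (Suc 0) = a" "coeff p (Suc (Suc 0)) = b" "coeff p (Suc (Suc (Suc 0))) = e"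
    "coeff p (Suc (Suc (Suc (Suc 0)))) = f"
    by (simp_all add: abef numeral_eq_Suc)
  have "coeff (transvectant4 n p) 0 = - 12 * (n - 2) * (2 * n * a * e - (n - 1) * b * b)"
    by (simp add: transvectant4_def c eval_nat_numeral coeff_pderiv s assms(1) algebra_simps)
  moreover have "coeff (transvectant4 n p) 1 = - 24 * (n - 3) * (3 * n * a * f - (n - 2) * b * e)"
    by (simp add: transvectant4_def c eval_nat_numeral coeff_pderiv s assms(1) algebra_simps)
  ultimately show ?thesis using r' assms(4) by (cases "i = 0") (auto simp: less_2_cases_iff)
qed

text \<open>Multiplying by x^4, split as x^k x^l with k + l = 4, makes every derivative diagonal. In
  degree n + m only the products of the x^n term with the x^m term contribute, and their sum factors
  as shown, with y the length n - m of the gap.\<close>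

lemma transvectant4_zero_top_terms:
  fixes p :: "'a::field poly" and n m :: nat
  assumes "transvectant4 (of_nat n) p = 0" "m < n" "coeff p n = 1"
    and gap: "\<And>i. m < i \<Longrightarrow> i \<noteq> n \<Longrightarrow> coeff p i = 0"
  defines "x \<equiv> of_nat n" and "y \<equiv> of_nat n - of_nat m"
  shows "coeff p m * x * (y + 1) * y * (y - 1) * ((y - 6) * (x + 1) + 12) = 0"
proof -
  let ?D = "\<lambda>k. monom 1 k * (pderiv ^^ k) p"
  have D: "coeff (?D k) i = (\<Prod>l<k. of_nat i - of_nat l) * coeff p i" for k i
    by (rule coeff_monom_mult_pderiv_funpow)
  have c: "coeff (?D k * ?D l) (n + m)
      = coeff (?D k) n * coeff (?D l) m + coeff (?D k) m * coeff (?D l) n" for k l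
    by (rule coeff_mult_two_top_terms[OF assms(2)]) (simp_all only: D, simp_all add: gap)
  have split: "?D k * ?D l = monom 1 4 * ((pderiv ^^ k) p * (pderiv ^^ l) p)"
    if "k + l = 4" for k l
  proof -
    have "monom 1 4 = monom 1 k * (monom 1 l :: 'a poly)" using that by (simp add: mult_monom)
    then show ?thesis by (simp add: mult_ac del: funpow.simps)
  qed
  have "0 = monom 1 4 * transvectant4 x p" using assms by simp
  also have "\<dots> = smult (x * (x + 1)) (?D 0 * ?D 4) - smult (4 * x * (x - 2)) (?D 1 * ?D 3)
     + smult (3 * (x - 1) * (x - 2)) (?D 2 * ?D 2)"
  proof -
    have "?D 0 * ?D 4 = monom 1 4 * (p * (pderiv ^^ 4) p)"
      "?D 1 * ?D 3 = monom 1 4 * (pderiv p * (pderiv ^^ 3) p)"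
      by (subst split; simp)+
    moreover have "?D 2 * ?D 2 = monom 1 4 * ((pderiv ^^ 2) p * (pderiv ^^ 2) p)"
      by (rule split) simp
    ultimately show ?thesis
      by (simp only: transvectant4_def distrib_left right_diff_distrib mult_smult_right)
  qed
  finally have "0 = coeff (smult (x * (x + 1)) (?D 0 * ?D 4) - smult (4 * x * (x - 2)) (?D 1 * ?D 3)
     + smult (3 * (x - 1) * (x - 2)) (?D 2 * ?D 2)) (n + m)" by (metis coeff_0)
  also have "\<dots> = coeff p m * x * (y + 1) * y * (y - 1) * ((y - 6) * (x + 1) + 12)"
    unfolding coeff_add coeff_diff coeff_smult c D assms(3) x_def y_def
    by (simp add: eval_nat_numeral algebra_simps)
  finally show ?thesis by simp
qed

section \<open>Sets whose nonzero differences are d-th roots of unity\<close>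

locale unit_differences =
  fixes A :: "'a::field set" and n :: nat
  assumes finite_A: "finite A" and card_A: "card A = n" and n_ge_4: "4 \<le> n"
    and unit_diff: "\<And>a b. a \<in> A \<Longrightarrow> b \<in> A \<Longrightarrow> a \<noteq> b \<Longrightarrow> (a - b) ^ (n * (n - 1)) = 1"
    and large_char: "\<And>k. 0 < k \<Longrightarrow> k < n ^ 2 \<Longrightarrow> of_nat k \<noteq> (0::'a)"
begin

abbreviation d where "d \<equiv> n * (n - 1)"
abbreviation N where "N \<equiv> d + (n - 1)"
abbreviation P where "P \<equiv> root_poly A"

text \<open>Used to move a root of P, and finally the mean of \<open>A\<close>, to 0.\<close>

lemma translate: "unit_differences ((\<lambda>x. x - c) ` A) n"
proof
  show "card ((\<lambda>x. x - c) ` A) = n" using card_A by (subst card_image) (auto simp: inj_on_def)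
qed (use finite_A n_ge_4 unit_diff large_char in auto)

lemma n_squared_eq: "n ^ 2 = d + n"
  using n_ge_4 by (simp add: power2_eq_square algebra_simps diff_mult_distrib2)

lemma four_n_le: "4 * n \<le> n ^ 2"
  using n_ge_4 by (simp add: power2_eq_square)

lemma degree_P: "degree P = n"
  using degree_root_poly finite_A card_A by blast

text \<open>N! is a product of positive integers below n^2, hence nonzero by
  \<open>large_char\<close>, and the binomial coefficient divides it.\<close>

lemma binomial_nonzero: "of_nat (N choose k) \<noteq> (0::'a)" if "k \<le> N"
proof -
  have "of_nat (fact m) \<noteq> (0::'a)" if "m \<le> N" for m
    using that
  proof (induction m)
    case (Suc m)
    have "Suc m < n ^ 2" using Suc.prems n_ge_4 by (simp add: n_squared_eq)
    then have "of_nat (Suc m) \<noteq> (0::'a)" by (intro large_char) auto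
    moreover have "of_nat (fact (Suc m)) = of_nat (Suc m) * (of_nat (fact m) :: 'a)"
      by (simp only: fact_Suc of_nat_mult of_nat_id)
    ultimately show ?case using Suc by simp
  qed simp
  from this[of N] show ?thesis
    using binomial_fact_lemma[OF that] by (metis le_refl of_nat_mult mult_zero_right)
qed

text \<open>Every nonzero a in \<open>A\<close> is a difference from 0, so (-a)^d = 1 and the
  exponent N - i drops to n - 1 - i, where the weighted power sums are known.\<close>

lemma coeff_weighted_power_sum_low:
  assumes "0 \<in> A" "i < n - 1"
  shows "coeff (weighted_power_sum A N) i = (if i = 0 then (-1) ^ (n - 1) else 0)"
proof -
  have "(\<Sum>a\<in>A. lagrange_weight A a * (-a) ^ (N - i))
      = (\<Sum>a\<in>A. lagrange_weight A a * (-1 * a) ^ (n - 1 - i))"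
  proof (rule sum.cong[OF refl])
    fix a assume a: "a \<in> A"
    show "lagrange_weight A a * (-a) ^ (N - i) = lagrange_weight A a * (-1 * a) ^ (n - 1 - i)"
    proof (cases "a = 0")
      case True
      \<comment> \<open>Both exponents must be positive for the term a = 0 to agree; this is where i
        < n - 1 is used.\<close>
      have "0 < N - i" "0 < n - 1 - i" using assms by auto
      then show ?thesis by (simp only: True minus_zero mult_zero_right zero_power)
    next
      case False
      have "N - i = d + (n - 1 - i)" using assms by simp
      then have "(-a) ^ (N - i) = (-a) ^ d * (-a) ^ (n - 1 - i)" by (simp only: power_add)
      then show ?thesis using unit_diff[of 0 a] a assms False by simp
    qed
  qed
  also have "\<dots> = (if i = 0 then (-1) ^ (n - 1) else 0)"
    using assms by (subst sum_lagrange_weight_power) (auto simp: finite_A card_A)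
  finally show ?thesis using assms by (simp add: coeff_weighted_power_sum)
qed

text \<open>The difference \<open>f\<close> of the two sides is divisible by P^(n-1), which has
  degree d, by the local expansion at each root. Its coefficients in degrees at least d vanish,
  since there the exponents N - i are at most n - 1. So \<open>f\<close> is zero.\<close>

lemma weighted_power_sum_eq:
  "weighted_power_sum A N = smult ((-1) ^ (n - 1)) (1 + smult (of_nat (N choose (n - 1))) (P ^ (n - 1)))"
proof -
  define e :: 'a where "e = (-1) ^ (n - 1)"
  define f where "f = weighted_power_sum A N - [:e:] - smult (e * of_nat (N choose (n - 1))) (P ^ (n - 1))"
  have degPn: "degree (P ^ (n - 1)) = d"
    using root_poly_nonzero[OF finite_A] by (simp add: degree_power_eq degree_P mult.commute)
  have d0: "0 < d" using n_ge_4 by simp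
  have "P ^ (n - 1) dvd weighted_power_sum A N - [:e:]"
  proof (rule root_poly_power_dvd[OF finite_A])
    fix a assume a: "a \<in> A"
    interpret T: unit_differences "(\<lambda>x. x - a) ` A" n by (rule translate)
    have "0 \<in> (\<lambda>x. x - a) ` A" using a by force
    from T.coeff_weighted_power_sum_low[OF this]
    show "[:-a, 1:] ^ (n - 1) dvd weighted_power_sum A N - [:e:]"
      by (auto simp: linear_power_dvd_iff pcompose_diff weighted_power_sum_translate e_def
          coeff_pCons split: nat.split)
  qed
  then have dvd: "P ^ (n - 1) dvd f" unfolding f_def by (rule dvd_diff) (rule dvd_smult[OF dvd_refl])
  have "coeff f i = 0" if i: "d \<le> i" for i
  proof (cases "i \<le> N")
    case False
    then show ?thesis using degPn degree_weighted_power_sum[of A N] d0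
      by (simp add: f_def coeff_eq_0 coeff_pCons split: nat.split)
  next
    case True
    have "coeff (weighted_power_sum A N) i
        = of_nat (N choose i) * (\<Sum>a\<in>A. lagrange_weight A a * (-1 * a) ^ (N - i))"
      using True by (simp add: coeff_weighted_power_sum)
    also have "\<dots> = (if i = d then of_nat (N choose d) * e else 0)"
      using True i n_ge_4 by (subst sum_lagrange_weight_power) (auto simp: finite_A card_A e_def)
    finally have "coeff (weighted_power_sum A N) i = (if i = d then of_nat (N choose d) * e else 0)" .
    moreover have "N choose d = N choose (n - 1)"
      using binomial_symmetric[of d N] by simp
    moreover have "coeff (P ^ (n - 1)) i = (if i = d then 1 else 0)"
    proof (cases "i = d")
      case True
      have "lead_coeff (P ^ (n - 1)) = 1"
        using coeff_root_poly_card[OF finite_A] by (simp add: lead_coeff_power degree_P card_A)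
      then show ?thesis using True degPn by simp
    qed (use i degPn coeff_eq_0[of "P ^ (n - 1)" i] in auto)
    ultimately show ?thesis using d0 i
      by (auto simp: f_def coeff_pCons split: nat.split)
  qed
  then have "f = 0 \<or> degree f < d"
    by (metis leI leading_coeff_0_iff)
  then have "f = 0" using dvd_imp_degree_le[OF dvd] degPn by (metis not_le)
  then show ?thesis by (simp add: f_def e_def smult_add_right algebra_simps one_pCons)
qed

text \<open>Write P = x Q and compare the coefficients of x^(n-1+i), i at most 3, in
  \<open>weighted_power_sum_eq\<close>. The left side gives inverse power sums \<open>S i\<close>,
  determined by Q through interpolation; the right side gives the coefficients of Q^(n-1).\<close>

lemma coeff_relations_at_zero:
  assumes zero: "0 \<in> A"
  shows "2 * of_nat n * coeff P 1 * coeff P 3 = (of_nat n - 1) * coeff P 2 * coeff P 2"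
    and "3 * of_nat n * coeff P 1 * coeff P 4 = (of_nat n - 2) * coeff P 2 * coeff P 3"
proof -
  define Q where "Q = root_poly (A - {0})"
  define W where "W = Q ^ (n - 1)"
  define S where "S i = (\<Sum>a\<in>A - {0}. lagrange_weight A a * inverse (-a) ^ i)" for i
  define C where "C i = (of_nat (N choose (n - 1 + i)) :: 'a)" for i
  let ?n = "of_nat n :: 'a"
  let ?q = "coeff Q" and ?w = "coeff W"
  have P: "P = pCons 0 Q"
    using root_poly_remove[OF finite_A zero] by (simp add: Q_def)
  have q0: "?q 0 \<noteq> 0"
    using poly_root_poly_eq_0_iff[of "A - {0}" 0] finite_A by (simp add: Q_def poly_0_coeff_0)
  have wt0: "lagrange_weight A 0 = inverse (?q 0)"
    by (simp add: lagrange_weight_def Q_def root_poly_def poly_0_coeff_0[symmetric] poly_prod)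
  have w0: "?w 0 \<noteq> 0"
    using q0 by (simp add: W_def poly_0_coeff_0[symmetric])
  have S0: "S 0 = - inverse (?q 0)"
  proof -
    have "(\<Sum>a\<in>A. lagrange_weight A a) = 0"
      using sum_lagrange_weight_power[OF finite_A, of 0 1] n_ge_4 card_A by simp
    then show ?thesis
      using sum.remove[OF finite_A zero, of "lagrange_weight A"] wt0
      by (simp add: S_def eq_neg_iff_add_eq_0 add.commute)
  qed
  have d3: "3 < d" using n_ge_4 mult_le_mono[of 4 n 3 "n - 1"] by linarith
  have CS: "C i * S i = (-1) ^ (n - 1) * C 0 * ?w i" if i: "i \<le> 3" for i
  proof -
    have "(\<Sum>a\<in>A. lagrange_weight A a * (-a) ^ (d - i)) = S i"
    proof -
      have "(-a) ^ (d - i) = inverse (-a) ^ i" if "a \<in> A - {0}" for a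
      proof -
        have "(-a) ^ i * (-a) ^ (d - i) = 1"
          using unit_diff[of 0 a] zero that i d3 by (simp flip: power_add)
        then show ?thesis by (metis inverse_unique power_inverse)
      qed
      then show ?thesis
        using i d3 by (simp add: sum.remove[OF finite_A zero] S_def)
    qed
    moreover have "n - 1 + i \<le> N" "N - (n - 1 + i) = d - i" using i d3 by auto
    ultimately have "C i * S i = coeff (weighted_power_sum A N) (n - 1 + i)"
      by (simp add: coeff_weighted_power_sum C_def)
    also have "\<dots> = (-1) ^ (n - 1) * C 0 * ?w i"
    proof -
      have "P ^ (n - 1) = monom 1 (n - 1) * W"
        by (simp add: P W_def monom_altdef power_mult_distrib[symmetric])
      then show ?thesis
        unfolding weighted_power_sum_eq C_def using n_ge_4 by (simp add: coeff_monom_mult)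
    qed
    finally show ?thesis .
  qed
  have C0: "C 0 \<noteq> 0" unfolding C_def by (rule binomial_nonzero) simp
  \<comment> \<open>The case i = 0 fixes the sign and the normalisation of the remaining
    equations.\<close>
  have "C 0 * ((-1) ^ (n - 1) * ?w 0) = C 0 * (- inverse (?q 0))"
    using CS[of 0] S0 by (simp add: mult_ac)
  then have e: "(-1) ^ (n - 1) * ?w 0 = - inverse (?q 0)"
    using C0 by (simp only: mult_cancel_left) simp
  have Cs: "C i * (?q 0 * S i) = - C 0 * (?w i / ?w 0)" if "i \<le> 3" for i
  proof -
    have "C i * (?q 0 * S i) = ?q 0 * ((-1) ^ (n - 1) * ?w 0) * C 0 * (?w i / ?w 0)"
      using CS[OF that] w0 by (simp add: mult_ac)
    then show ?thesis unfolding e using q0 by simp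
  qed
  have Crec: "C (Suc i) * (?n + of_nat i) = (of_nat d - of_nat i) * C i" if "i \<le> 3" for i
  proof -
    have "(n + i) * (N choose (n + i)) = (N - (n - 1 + i)) * (N choose (n - 1 + i))"
      using binomial_absorption_step[of "n - 1 + i" N] n_ge_4 by simp
    moreover have "N - (n - 1 + i) = d - i" "n - 1 + Suc i = n + i" using that d3 n_ge_4 by auto
    ultimately have "of_nat ((n + i) * (N choose (n + i))) = (of_nat ((d - i) * (N choose (n - 1 + i))) :: 'a)"
      by simp
    then show ?thesis using that d3 \<open>n - 1 + Suc i = n + i\<close>
      by (simp add: C_def of_nat_diff mult_ac)
  qed
  \<comment> \<open>Division of x Q by x - a, carried out from the lowest coefficient
    upwards.\<close>
  have V: "coeff (root_poly (A - {a})) (Suc k)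
      = inverse (-a) * (?q k - coeff (root_poly (A - {a})) k)" 
    "coeff (root_poly (A - {a})) 0 = 0" if "a \<in> A - {0}" for a k
  proof -
    have *: "pCons 0 Q = [:-a, 1:] * root_poly (A - {a})"
      using root_poly_remove[OF finite_A, of a] that P by simp
    show "coeff (root_poly (A - {a})) 0 = 0"
      using arg_cong[OF *, of "\<lambda>p. coeff p 0"] that by simp
    show "coeff (root_poly (A - {a})) (Suc k)
      = inverse (-a) * (?q k - coeff (root_poly (A - {a})) k)"
      using arg_cong[OF *, of "\<lambda>p. coeff p (Suc k)"] that by (simp add: field_simps)
  qed
  \<comment> \<open>Interpolate the constant 1: its coefficients of positive degree are 0, and the
    summand for a = 0 is a multiple of Q.\<close>
  have sumV: "(\<Sum>a\<in>A - {0}. lagrange_weight A a * coeff (root_poly (A - {a})) (Suc k)) 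
      = - inverse (?q 0) * ?q (Suc k)" for k
  proof -
    have "1 = (\<Sum>a\<in>A. smult (lagrange_weight A a) (root_poly (A - {a})))"
      using lagrange_interpolation[OF finite_A, of 1] card_A n_ge_4 by simp
    from arg_cong[OF this, of "\<lambda>p. coeff p (Suc k)"]
    have "0 = (\<Sum>a\<in>A. lagrange_weight A a * coeff (root_poly (A - {a})) (Suc k))"
      by (simp add: coeff_sum)
    then show ?thesis
      by (simp add: sum.remove[OF finite_A zero] wt0 Q_def[symmetric] eq_neg_iff_add_eq_0 add.commute)
  qed
  have V1: "coeff (root_poly (A - {a})) 1 = inverse (-a) * ?q 0" if "a \<in> A - {0}" for a
    using V(1)[OF that, of 0] V(2)[OF that] by simp
  have V2: "coeff (root_poly (A - {a})) 2 = inverse (-a) * ?q 1 - inverse (-a) ^ 2 * ?q 0"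
    if "a \<in> A - {0}" for a
    using V(1)[OF that, of 1] unfolding V1[OF that] by (simp add: eval_nat_numeral algebra_simps)
  have V3: "coeff (root_poly (A - {a})) 3
      = inverse (-a) * ?q 2 - inverse (-a) ^ 2 * ?q 1 + inverse (-a) ^ 3 * ?q 0"
    if "a \<in> A - {0}" for a
    using V(1)[OF that, of 2] unfolding V2[OF that] by (simp add: eval_nat_numeral algebra_simps)
  note expand = S_def right_diff_distrib distrib_left sum_subtractf sum.distrib sum_distrib_right
    mult.assoc power_one_right
  have s1: "S 1 * ?q 0 = - inverse (?q 0) * ?q 1"
  proof -
    have "S 1 * ?q 0 = (\<Sum>a\<in>A - {0}. lagrange_weight A a * (inverse (-a) * ?q 0))"
      by (simp only: expand)
    also have "\<dots> = (\<Sum>a\<in>A - {0}. lagrange_weight A a * coeff (root_poly (A - {a})) 1)"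
      by (rule sum.cong[OF refl]) (simp only: V1)
    finally show ?thesis using sumV[of 0] by simp
  qed
  have s2: "S 1 * ?q 1 - S 2 * ?q 0 = - inverse (?q 0) * ?q 2"
  proof -
    have "S 1 * ?q 1 - S 2 * ?q 0
        = (\<Sum>a\<in>A - {0}. lagrange_weight A a * (inverse (-a) * ?q 1 - inverse (-a) ^ 2 * ?q 0))"
      by (simp only: expand)
    also have "\<dots> = (\<Sum>a\<in>A - {0}. lagrange_weight A a * coeff (root_poly (A - {a})) 2)"
      by (rule sum.cong[OF refl]) (simp only: V2)
    finally show ?thesis using sumV[of 1] by (simp add: eval_nat_numeral)
  qed
  have s3: "S 1 * ?q 2 - S 2 * ?q 1 + S 3 * ?q 0 = - inverse (?q 0) * ?q 3"
  proof -
    have "S 1 * ?q 2 - S 2 * ?q 1 + S 3 * ?q 0 = (\<Sum>a\<in>A - {0}. lagrange_weight A a *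
        (inverse (-a) * ?q 2 - inverse (-a) ^ 2 * ?q 1 + inverse (-a) ^ 3 * ?q 0))"
      by (simp only: expand)
    also have "\<dots> = (\<Sum>a\<in>A - {0}. lagrange_weight A a * coeff (root_poly (A - {a})) 3)"
      by (rule sum.cong[OF refl]) (simp only: V3)
    finally show ?thesis using sumV[of 2] by (simp add: eval_nat_numeral)
  qed
  \<comment> \<open>The logarithmic derivative of W = Q^(n-1) gives its coefficients
    recursively.\<close>
  have "Q * pderiv W = smult (of_nat (n - 1)) (pderiv Q * W)"
  proof -
    obtain k where "n - 1 = Suc k" using n_ge_4 by (cases "n - 1") auto
    then show ?thesis
      unfolding W_def \<open>n - 1 = Suc k\<close> pderiv_power_Suc by (simp add: mult_ac del: of_nat_Suc)
  qed
  then have pd: "coeff (Q * pderiv W) i = (?n - 1) * coeff (pderiv Q * W) i" for i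
    using n_ge_4 by (simp add: of_nat_diff)
  have w1: "?q 0 * ?w 1 = (?n - 1) * (?q 1 * ?w 0)"
    using pd[of 0] by (simp add: coeff_mult coeff_pderiv)
  have w2: "2 * ?q 0 * ?w 2 + ?q 1 * ?w 1 = (?n - 1) * (2 * ?q 2 * ?w 0 + ?q 1 * ?w 1)"
    using pd[of 1] by (simp add: coeff_mult coeff_pderiv eval_nat_numeral algebra_simps)
  have w3: "3 * ?q 0 * ?w 3 + 2 * ?q 1 * ?w 2 + ?q 2 * ?w 1
      = (?n - 1) * (3 * ?q 3 * ?w 0 + 2 * ?q 2 * ?w 1 + ?q 1 * ?w 2)"
    using pd[of 2] by (simp add: coeff_mult coeff_pderiv eval_nat_numeral algebra_simps)
  define \<alpha> \<beta> \<gamma> where "\<alpha> = ?q 1 / ?q 0" "\<beta> = ?q 2 / ?q 0" "\<gamma> = ?q 3 / ?q 0"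
  note greek = this
  define y where "y i = ?w i / ?w 0" for i
  define s where "s i = ?q 0 * S i" for i
  have q: "?q 1 = \<alpha> * ?q 0" "?q 2 = \<beta> * ?q 0" "?q 3 = \<gamma> * ?q 0" using q0 by (simp_all add: greek)
  have w: "?w i = y i * ?w 0" for i using w0 by (simp add: y_def)
  have "of_nat n \<noteq> (0::'a)" "of_nat (n - 1) \<noteq> (0::'a)" "of_nat (n - 3) \<noteq> (0::'a)"
    "of_nat (n + 1) \<noteq> (0::'a)" "of_nat 2 \<noteq> (0::'a)"
    using n_ge_4 four_n_le by (intro large_char; linarith)+
  then have nz: "?n \<noteq> 0" "?n - 1 \<noteq> 0" "?n - 3 \<noteq> 0" "?n + 1 \<noteq> 0" "(2::'a) \<noteq> 0"
    using n_ge_4 by (simp_all add: of_nat_diff add.commute)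
  have dn: "of_nat d = ?n * (?n - 1)" using n_ge_4 by (simp add: of_nat_diff)
  have S1: "s 1 = - \<alpha>" using s1 q0 by (simp add: s_def greek field_simps)
  have S2: "s 2 = \<beta> - \<alpha>^2"
  proof -
    have "\<alpha> * s 1 - s 2 = - \<beta>" using s2 q0 unfolding q s_def by (simp add: mult_ac)
    then show ?thesis unfolding S1 by (simp add: algebra_simps power2_eq_square)
  qed
  have S3: "s 3 = - \<gamma> + 2 * \<alpha> * \<beta> - \<alpha>^3"
  proof -
    have "\<beta> * s 1 - \<alpha> * s 2 + s 3 = - \<gamma>" using s3 q0 unfolding q s_def by (simp add: mult_ac)
    then show ?thesis unfolding S1 S2 by (simp add: algebra_simps power2_eq_square power3_eq_cube)
  qed
  have y1: "y 1 = (?n - 1) * \<alpha>"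
    using w1 q0 w0 unfolding q w[of 1] by (simp add: mult_ac)
  have y2: "2 * y 2 + \<alpha> * y 1 = (?n - 1) * (2 * \<beta> + \<alpha> * y 1)"
  proof -
    have "(?q 0 * ?w 0) * (2 * y 2 + \<alpha> * y 1) = (?q 0 * ?w 0) * ((?n - 1) * (2 * \<beta> + \<alpha> * y 1))"
      using w2 unfolding q w[of 1] w[of 2] by (simp add: algebra_simps)
    then show ?thesis using q0 w0 by simp
  qed
  have y3: "3 * y 3 + 2 * \<alpha> * y 2 + \<beta> * y 1 = (?n - 1) * (3 * \<gamma> + 2 * \<beta> * y 1 + \<alpha> * y 2)"
  proof -
    have "(?q 0 * ?w 0) * (3 * y 3 + 2 * \<alpha> * y 2 + \<beta> * y 1)
      = (?q 0 * ?w 0) * ((?n - 1) * (3 * \<gamma> + 2 * \<beta> * y 1 + \<alpha> * y 2))"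
      using w3 unfolding q w[of 1] w[of 2] w[of 3] by (simp add: algebra_simps)
    then show ?thesis using q0 w0 by simp
  qed
  have "C 1 * ?n = ?n * (?n - 1) * C 0" "C 2 * (?n + 1) = (?n * (?n - 1) - 1) * C 1"
    "C 3 * (?n + 2) = (?n * (?n - 1) - 2) * C 2"
    using Crec[of 0, unfolded dn] Crec[of 1, unfolded dn] Crec[of 2, unfolded dn]
    by (simp_all add: numeral_2_eq_2 numeral_3_eq_3)
  moreover have "C 2 * s 2 = - C 0 * y 2" "C 3 * s 3 = - C 0 * y 3"
    using Cs[of 2] Cs[of 3] by (simp_all add: s_def y_def)
  ultimately have "2 * ?n * \<beta> = (?n - 1) * \<alpha>^2" "3 * ?n * \<gamma> = (?n - 2) * \<alpha> * \<beta>"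
    using local_coefficient_relations[OF y1 y2 y3 S2 S3, of "C 1" "C 0" "C 2" "C 3"] C0 nz
    by blast+
  then have "2 * ?n * \<beta> * (?q 0)^2 = (?n - 1) * \<alpha>^2 * (?q 0)^2"
    "3 * ?n * \<gamma> * (?q 0)^2 = (?n - 2) * \<alpha> * \<beta> * (?q 0)^2" by simp_all
  moreover have "coeff P 1 = ?q 0" "coeff P 2 = \<alpha> * ?q 0" "coeff P 3 = \<beta> * ?q 0" "coeff P 4 = \<gamma> * ?q 0"
    using q by (simp_all add: P eval_nat_numeral)
  ultimately show "2 * ?n * coeff P 1 * coeff P 3 = (?n - 1) * coeff P 2 * coeff P 2"
    "3 * ?n * coeff P 1 * coeff P 4 = (?n - 2) * coeff P 2 * coeff P 3"
    by (simp_all add: power2_eq_square mult_ac)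
qed

text \<open>The coefficient relations make each root of P at least a double zero, which exceeds what
  the degree permits unless the transvectant is zero.\<close>

lemma transvectant4_root_poly: "transvectant4 (of_nat n) P = 0"
proof (rule ccontr)
  assume nz: "transvectant4 (of_nat n) P \<noteq> 0"
  have "P ^ 2 dvd transvectant4 (of_nat n) P"
  proof (rule root_poly_power_dvd[OF finite_A])
    fix a assume a: "a \<in> A"
    interpret T: unit_differences "(\<lambda>x. x - a) ` A" n by (rule translate)
    have zero: "0 \<in> (\<lambda>x. x - a) ` A" using a by force
    then have "coeff T.P 0 = 0"
      using poly_root_poly_eq_0_iff[OF T.finite_A, of 0] by (simp add: poly_0_coeff_0)
    then have "coeff (transvectant4 (of_nat n) T.P) i = 0" if "i < 2" for i
      using coeff_transvectant4_low[OF _ T.coeff_relations_at_zero[OF zero] that] by blast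
    then show "[:-a, 1:] ^ 2 dvd transvectant4 (of_nat n) P"
      by (simp add: linear_power_dvd_iff transvectant4_pcompose_shift[symmetric] root_poly_translate)
  qed
  from dvd_imp_degree_le[OF this nz] show False
    using degree_transvectant4[of P "of_nat n"] degree_P n_ge_4 root_poly_nonzero[OF finite_A]
    by (simp add: degree_power_eq)
qed

section \<open>From the vanishing transvectant to the two exceptional values of n\<close>

lemma of_int_eq_0_imp:
  assumes "of_int k = (0::'a)" "\<bar>k\<bar> < int (n ^ 2)"
  shows "k = 0"
proof (rule ccontr)
  assume "k \<noteq> 0"
  then have "of_nat (nat \<bar>k\<bar>) \<noteq> (0::'a)"
    using assms(2) by (intro large_char) (auto simp: nat_less_iff)
  moreover have "of_nat (nat \<bar>k\<bar>) = (of_int \<bar>k\<bar> :: 'a)" by (simp add: of_nat_nat)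
  ultimately show False using assms(1) by (auto simp: abs_if split: if_splits)
qed

lemma exceptional_cases_centred:
  assumes centred: "\<Sum>A = 0"
  shows "\<exists>j. (n = 5 \<and> j = 4 \<or> n = 11 \<and> j = 5) \<and>
    (-1) ^ j * of_nat (N choose (n - 1 + j)) + of_nat ((n - 1) * (N choose (n - 1))) = (0::'a)"
proof -
  define R where "R = P - monom 1 n"
  define m where "m = degree R"
  have Pn: "coeff P n = 1" using coeff_root_poly_card[OF finite_A] card_A by simp
  \<comment> \<open>A second term exists because x^n has 0 as its only root. Centring puts its
    degree m below n - 1.\<close>
  have "R \<noteq> 0"
  proof
    assume "R = 0"
    then have "P = monom 1 n" by (simp add: R_def)
    then have "A \<subseteq> {0}"
      using poly_root_poly_eq_0_iff[OF finite_A] by (auto simp: poly_monom)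
    then have "card A \<le> 1" using card_mono[of "{0}" A] by simp
    then show False using card_A n_ge_4 by simp
  qed
  then have Rm: "coeff R m \<noteq> 0" by (simp add: m_def)
  have "coeff R i = 0" if i: "n - 1 \<le> i" for i
  proof -
    consider "i = n - 1" | "i = n" | "n < i" using i n_ge_4 by linarith
    then show ?thesis
    proof cases
      case 1
      then show ?thesis
        using coeff_root_poly_pred[OF finite_A] card_A centred n_ge_4 by (force simp: R_def)
    next
      case 2
      then show ?thesis using Pn by (simp add: R_def)
    next
      case 3
      then show ?thesis using degree_P by (simp add: R_def coeff_eq_0)
    qed
  qed
  then have mn: "m < n - 1" using Rm by (meson not_le)
  have gap: "coeff P i = 0" if "m < i" "i \<noteq> n" for i
    using that coeff_eq_0[of R i] by (simp add: R_def m_def)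
  have Pm: "coeff P m \<noteq> 0" using Rm mn by (auto simp: R_def split: if_splits)
  define j where "j = n - m"
  have j: "2 \<le> j" "j \<le> n" "n - j = m" using mn by (auto simp: j_def)
  have jf: "of_nat n - of_nat m = (of_nat j :: 'a)" using j by (simp add: j_def of_nat_diff)
  have "of_nat n \<noteq> (0::'a)" "of_nat (j + 1) \<noteq> (0::'a)" "of_nat j \<noteq> (0::'a)" "of_nat (j - 1) \<noteq> (0::'a)"
    using j n_ge_4 four_n_le by (intro large_char; linarith)+
  then have nz: "of_nat n \<noteq> (0::'a)" "of_nat j + 1 \<noteq> (0::'a)" "of_nat j \<noteq> (0::'a)" "of_nat j - 1 \<noteq> (0::'a)"
    using j by (simp_all add: of_nat_diff add.commute)
  let ?k = "(int j - 6) * (int n + 1) + 12"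
  have "(of_nat j - 6) * (of_nat n + 1) + 12 = (0::'a)"
    using transvectant4_zero_top_terms[OF transvectant4_root_poly _ Pn gap, of m] mn Pm nz
    by (simp add: jf)
  then have "of_int ?k = (0::'a)" by simp
  \<comment> \<open>This bound lifts the equation from the field to the integers. For j at least 6
    it follows from j at most n; the four smaller values of j are checked directly.\<close>
  moreover have "\<bar>?k\<bar> < int (n ^ 2)"
  proof (cases "6 \<le> j")
    case True
    have "(int j - 6) * (int n + 1) \<le> (int n - 6) * (int n + 1)"
      using j by (intro mult_right_mono) auto
    moreover have "(int n - 6) * (int n + 1) + 12 < int (n ^ 2)"
      using n_ge_4 by (simp add: algebra_simps power2_eq_square)
    moreover have "0 \<le> (int j - 6) * (int n + 1)" using True by simp
    ultimately show ?thesis by linarith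
  next
    case False
    then have "j = 2 \<or> j = 3 \<or> j = 4 \<or> j = 5" using j by auto
    moreover have "4 * int n \<le> int (n ^ 2)" using four_n_le by (metis of_nat_le_iff of_nat_mult of_nat_numeral)
    ultimately show ?thesis using n_ge_4 by (elim disjE) (simp_all del: of_nat_power)
  qed
  ultimately have k: "?k = 0" by (rule of_int_eq_0_imp)
  have "j < 6"
  proof (rule ccontr)
    assume "\<not> j < 6"
    then have "0 \<le> (int j - 6) * (int n + 1)" by simp
    then show False using k by linarith
  qed
  then have "j = 2 \<or> j = 3 \<or> j = 4 \<or> j = 5" using j by auto
  \<comment> \<open>The equation reads (6 - j) (n + 1) = 12. The values j = 2 and j = 3 give n = 2
    and n = 3, below the assumed 4.\<close>
  then have cases: "n = 5 \<and> j = 4 \<or> n = 11 \<and> j = 5"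
    using k n_ge_4 by (elim disjE) simp_all
  have jd: "j < d" using cases by auto
  have le: "d - j \<le> N" by (rule le_trans[OF diff_le_self le_add1])
  have eq: "N - (d - j) = n - 1 + j" using jd by auto
  \<comment> \<open>This coefficient is computed on both sides of the identity. Both are multiples
    of \<open>coeff P m\<close>, which is nonzero and cancels; as d - j is positive, the summand 1
    does not contribute.\<close>
  have "coeff (weighted_power_sum A N) (d - j)
      = of_nat (N choose (d - j)) * (\<Sum>a\<in>A. lagrange_weight A a * (-a) ^ (n - 1 + j))"
    using coeff_weighted_power_sum[OF le, of A] by (simp only: eq)
  also have "N choose (d - j) = N choose (n - 1 + j)"
    using binomial_symmetric[OF le] by (simp only: eq)
  also have "(\<Sum>a\<in>A. lagrange_weight A a * (-a) ^ (n - 1 + j))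
      = (-1) ^ (n - 1 + j) * (\<Sum>a\<in>A. lagrange_weight A a * a ^ (n - 1 + j))"
    by (subst sum_distrib_left, rule sum.cong[OF refl], subst power_minus) simp
  also have "(\<Sum>a\<in>A. lagrange_weight A a * a ^ (n - 1 + j)) = - coeff P m"
    using sum_lagrange_weight_power_beyond[OF finite_A, of j] j gap card_A by simp
  finally have "of_nat (N choose (n - 1 + j)) * ((-1) ^ (n - 1 + j) * - coeff P m)
      = coeff (weighted_power_sum A N) (d - j)" by simp
  also have "\<dots> = (-1) ^ (n - 1) * (of_nat (N choose (n - 1)) * coeff (P ^ (n - 1)) (d - j))"
    unfolding weighted_power_sum_eq using jd by simp
  also have "coeff (P ^ (n - 1)) (d - j) = of_nat (n - 1) * coeff P m"
    using coeff_power_below_top[of P j "n - 1"] degree_P Pn j n_ge_4 gap by simp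
  finally have top: "of_nat (N choose (n - 1 + j)) * ((-1) ^ (n - 1 + j) * - coeff P m)
      = (-1) ^ (n - 1) * (of_nat (N choose (n - 1)) * (of_nat (n - 1) * coeff P m))" .
  have "e * c * (s * x + z * y) = 0" if "x * (e * s * - c) = e * (y * (z * c))" for e c s x y z :: 'a
  proof -
    have "e * c * (s * x + z * y) = e * (y * (z * c)) - x * (e * s * - c)"
      by (simp add: algebra_simps)
    then show ?thesis unfolding that by simp
  qed
  from this[OF top[unfolded power_add]]
  have "(-1) ^ (n - 1) * coeff P m * ((-1) ^ j * of_nat (N choose (n - 1 + j))
      + of_nat ((n - 1) * (N choose (n - 1)))) = 0"
    by (simp only: of_nat_mult)
  then show ?thesis using cases Pm by auto
qed

lemma exceptional_cases:
  "n = 5 \<and> of_nat ((24 choose 8) + 4 * (24 choose 4)) = (0::'a) \<or>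
   n = 11 \<and> of_nat (120 choose 15) = (of_nat (10 * (120 choose 10)) :: 'a)"
proof -
  \<comment> \<open>The mean of \<open>A\<close> exists because n is invertible.\<close>
  have n0: "of_nat n \<noteq> (0::'a)" using large_char[of n] n_ge_4 four_n_le by simp
  define c where "c = \<Sum>A / of_nat n"
  interpret T: unit_differences "(\<lambda>x. x - c) ` A" n by (rule translate)
  have "\<Sum>((\<lambda>x. x - c) ` A) = (\<Sum>a\<in>A. a - c)"
    by (subst sum.reindex) (auto simp: inj_on_def)
  also have "\<dots> = 0" using n0 by (simp add: sum_subtractf card_A c_def)
  finally show ?thesis using T.exceptional_cases_centred by (auto simp: add.commute)
qed

end

section \<open>Application to the prime field\<close>

theorem theorem4:
  fixes p d :: nat
  assumes "p = CARD('p::prime_card)"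
    and "d dvd p - 1" and "1 < d" and "d < p - 1" and "d \<notin> {2, 6}"
    and "\<not> (p = 41 \<and> d = 20)"
  shows "\<not> (\<exists>A :: 'p mod_ring set. d_critical d A (uminus ` A))"
proof
  assume "\<exists>A :: 'p mod_ring set. d_critical d A (uminus ` A)"
  then obtain A :: "'p mod_ring set" where crit: "d_critical d A (uminus ` A)" ..
  define n where "n = card A"
  have "card (uminus ` A) = n" unfolding n_def by (rule card_image) simp
  \<comment> \<open>With B = -A the intersection in the definition is -A itself, of size n.\<close>
  then have nn: "n * n = d + n" and n1: "1 < n"
    using crit by (auto simp: d_critical_def n_def)
  then have d: "d = n * (n - 1)" by (simp add: diff_mult_distrib2)
  \<comment> \<open>These sizes correspond to the excluded d = 2 and d = 6.\<close>
  have "n \<noteq> 2" "n \<noteq> 3" using d assms(5) by auto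
  then have n4: "4 \<le> n" using n1 by linarith
  obtain q where q: "p - 1 = d * q" using assms(2) by (elim dvdE)
  \<comment> \<open>As a proper divisor of p - 1, d is at most half of it; this gives p > n^2, the
    source of \<open>large_char\<close>.\<close>
  have "q \<noteq> 0" "q \<noteq> 1" using q assms(3,4) by auto
  then have "d * 2 \<le> p - 1" unfolding q by (intro mult_le_mono2) linarith
  then have p_big: "2 * d < p" using assms(3) by linarith
  have "4 * n \<le> n * n" using n4 by simp
  then have "n ^ 2 \<le> 2 * d" using nn n4 unfolding power2_eq_square by linarith
  then have p_gt: "n ^ 2 < p" using p_big by linarith
  have dvd: "p dvd k" if "of_nat k = (0::'p mod_ring)" for k
    using of_nat_0_mod_ring_dvd[OF that] assms(1) by simp
  have prime: "prime p" using assms(1) prime_card by simp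
  interpret unit_differences A n
  proof
    show "finite A" by simp
    show "card A = n" by (simp add: n_def)
    show "4 \<le> n" by (rule n4)
    show "(a - b) ^ (n * (n - 1)) = 1" if "a \<in> A" "b \<in> A" "a \<noteq> b" for a b
    proof -
      have "a + - b \<in> roots_unity d \<union> {0}"
        using crit that unfolding d_critical_def by blast
      then show ?thesis using that d by (simp add: roots_unity_def)
    qed
    show "of_nat k \<noteq> (0::'p mod_ring)" if "0 < k" "k < n ^ 2" for k
    proof
      assume "of_nat k = (0::'p mod_ring)"
      then have "p \<le> k" using dvd that by (intro dvd_imp_le) auto
      then show False using that p_gt by linarith
    qed
  qed
  from exceptional_cases show False
  proof (elim disjE conjE)
    assume n: "n = 5" and "of_nat ((24 choose 8) + 4 * (24 choose 4)) = (0::'p mod_ring)"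
    then have "p dvd (24 choose 8) + 4 * (24 choose 4)" by (intro dvd)
    \<comment> \<open>Among the prime divisors only 41 exceeds 2 d = 40, which leaves the stated
      exception.\<close>
    also have "(24 choose 8) + 4 * (24 choose 4) = 41 * 18975"
      by (simp add: binomial_fact' fact_numeral)
    also have "\<dots> = 41 * (3 * 5 * 5 * 11 * 23)" by simp
    finally have "p dvd 41 \<or> p dvd 3 \<or> p dvd 5 \<or> p dvd 11 \<or> p dvd 23"
      using prime by (simp only: prime_dvd_mult_iff) blast
    moreover have "40 < p" using p_big d n by simp
    ultimately have "p dvd 41" by (auto dest: dvd_imp_le)
    then have "p = 41" using \<open>40 < p\<close> by (auto dest: dvd_imp_le)
    then show False using assms(6) d n by simp
  next
    assume n: "n = 11"
      and eq: "of_nat (120 choose 15) = (of_nat (10 * (120 choose 10)) :: 'p mod_ring)"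
    let ?b = "of_nat (120 choose 10) :: 'p mod_ring"
    have b: "?b \<noteq> 0" using binomial_nonzero[of 10] n by simp
    \<comment> \<open>Five absorption steps relate the two binomial coefficients, so that
      \<open>120 choose 10\<close> can be cancelled instead of evaluated.\<close>
    have "15 * 14 * 13 * 12 * 11 * (120 choose 15) = 110 * 109 * 108 * 107 * 106 * (120 choose 10)"
      using binomial_absorption_step[of 10 120] binomial_absorption_step[of 11 120]
        binomial_absorption_step[of 12 120] binomial_absorption_step[of 13 120]
        binomial_absorption_step[of 14 120]
      by simp
    then have "of_nat (15 * 14 * 13 * 12 * 11 * (120 choose 15))
      = (of_nat (110 * 109 * 108 * 107 * 106 * (120 choose 10)) :: 'p mod_ring)" by (rule arg_cong)
    then have "?b * of_nat (15 * 14 * 13 * 12 * 11 * 10) = ?b * of_nat (110 * 109 * 108 * 107 * 106)"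
      unfolding of_nat_mult[of _ "120 choose 15"] eq by (simp add: mult_ac)
    then have "of_nat (110 * 109 * 108 * 107 * 106 - 15 * 14 * 13 * 12 * 11 * 10) = (0 :: 'p mod_ring)"
      using b by (subst of_nat_diff) (simp_all only: mult_cancel_left, simp_all)
    then have "p dvd 110 * 109 * 108 * 107 * 106 - 15 * 14 * 13 * 12 * 11 * 10" by (rule dvd)
    \<comment> \<open>Every factor is below 2 d = 220, while p is above it.\<close>
    also have "\<dots> = (110 * 121 * 144 * 47 * 163 :: nat)" by simp
    finally have "p dvd 110 \<or> p dvd 121 \<or> p dvd 144 \<or> p dvd 47 \<or> p dvd 163"
      using prime by (simp only: prime_dvd_mult_iff) blast
    moreover have "220 < p" using p_big d n by simp
    ultimately show False by (auto dest: dvd_imp_le)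
  qed
qed
end
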